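(* For each energy $E<0$ there exists a Langmuir orbit of energy $E$. Explicitly: for every real $E<0$ there exist a height $h>0$ with $\frac{7}{2h}+E\ge 0$ and a time $T>0$ such that the solution $(x(t),y(t))$ of the Langmuir problem at energy $E$ and height $h$ exists on $[0,T]$ (with $y>0$) and satisfies $\dot x(T)=\dot y(T)=0$.
   Context: Consider, on the region $\{(x,y)\in\mathbb{R}^2 : y>0\}$, the system of ordinary differential equations $$\ddot{x}=\frac{-8x}{(x^2+y^2)^{3/2}},\qquad \ddot{y}=\frac{-8y}{(x^2+y^2)^{3/2}}+\frac{1}{y^2}.$$ These are the equations of motion $\dot q=2p$, $\dot p=-\nabla V$ (with $q=(x,y)$) of the Langmuir Hamiltonian $H(x,y,p)=|p|^2+V(x,y)$ with Langmuir potential $V(x,y)=-\frac{4}{\sqrt{x^2+y^2}}+\frac{1}{2y}$. The energy of a solution is the constant value of $H$ along it, i.e. $\frac14(\dot x^2+\dot y^2)+V(x,y)$. Langmuir problem: for an energy $E\le 0$ and a height $h>0$ satisfying $\frac{7}{2h}+E\ge 0$, the Langmuir problem at energy $E$ and height $h$ is the initial value problem for the system $\ddot{x}=\frac{-8x}{(x^2+y^2)^{3/2}}$, $\ddot{y}=\frac{-8y}{(x^2+y^2)^{3/2}}+\frac{1}{y^2}$ (in the region $y>0$) with initial conditions $$x(0)=0,\quad y(0)=h,\quad \dot x(0)=2\sqrt{\tfrac{7}{2h}+E},\quad \dot y(0)=0.$$ Its solution has energy $E$. Langmuir orbit: a Langmuir orbit of energy $E$ is a solution to the Langmuir problem at energy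 $E$ (with some height $h$) whose velocity vector $(\dot x,\dot y)$ vanishes at some time $T>0$. *)

theory Defs
  imports "HOL-Analysis.Analysis"
begin

text \<open>
  The functions \<open>u\<close> and \<open>v\<close> are the velocities of \<open>x\<close> and \<open>y\<close>. Derivatives are taken within the
  time interval \<open>I\<close>, hence are one-sided at any endpoint that belongs to \<open>I\<close>.
\<close>

definition solves_langmuir_system ::
  "real set \<Rightarrow> (real \<Rightarrow> real) \<Rightarrow> (real \<Rightarrow> real) \<Rightarrow> (real \<Rightarrow> real) \<Rightarrow> (real \<Rightarrow> real) \<Rightarrow> bool"
  where "solves_langmuir_system I x y u v \<longleftrightarrow>
    (\<forall>t\<in>I. y t > 0 \<and>
      (x has_real_derivative u t) (at t within I) \<and>
      (y has_real_derivative v t) (at t within I) \<and>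
      (u has_real_derivative - 8 * x t / ((x t)\<^sup>2 + (y t)\<^sup>2) powr (3/2)) (at t within I) \<and>
      (v has_real_derivative - 8 * y t / ((x t)\<^sup>2 + (y t)\<^sup>2) powr (3/2) + 1 / (y t)\<^sup>2)
        (at t within I))"

definition admissible_height :: "real \<Rightarrow> real \<Rightarrow> bool"
  where "admissible_height E h \<longleftrightarrow> h > 0 \<and> 7 / (2 * h) + E \<ge> 0"

definition solves_langmuir_problem ::
  "real \<Rightarrow> real \<Rightarrow> real set \<Rightarrow>
    (real \<Rightarrow> real) \<Rightarrow> (real \<Rightarrow> real) \<Rightarrow> (real \<Rightarrow> real) \<Rightarrow> (real \<Rightarrow> real) \<Rightarrow> bool"
  where "solves_langmuir_problem E h I x y u v \<longleftrightarrow>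
    E \<le> 0 \<and> admissible_height E h \<and>
    solves_langmuir_system I x y u v \<and>
    x 0 = 0 \<and> y 0 = h \<and> u 0 = 2 * sqrt (7 / (2 * h) + E) \<and> v 0 = 0"

definition langmuir_orbit ::
  "real \<Rightarrow> real \<Rightarrow> real \<Rightarrow>
    (real \<Rightarrow> real) \<Rightarrow> (real \<Rightarrow> real) \<Rightarrow> (real \<Rightarrow> real) \<Rightarrow> (real \<Rightarrow> real) \<Rightarrow> bool"
  where "langmuir_orbit E h T x y u v \<longleftrightarrow>
    T > 0 \<and> solves_langmuir_problem E h {0..T} x y u v \<and> u T = 0 \<and> v T = 0"

end

theory Submission
  imports Defs
begin

text \<open>
  A Langmuir orbit is traversed backwards from its zero velocity point. So consider \<^emph>\<open>brake
  orbits\<close>, which start at rest at a point \<open>(a, 1)\<close> with \<open>a > 0\<close>, and look for one that crosses the axis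
  \<open>x = 0\<close> perpendicularly. Time reversal and the scaling symmetry of the system then turn one such
  orbit of negative energy into a Langmuir orbit of any prescribed negative energy
  (\<open>brake_orbit_gives_langmuir_orbit\<close>).

  The perpendicular crossing is found by shooting with the parameter \<open>a \<in> {sqrt 3..sqrt 63}\<close>. As long
  as \<open>x > 0\<close>, the horizontal velocity decreases, and the angular momentum \<open>x * v - y * u\<close> increases
  from \<open>0\<close>, because its derivative is \<open>x / y\<^sup>2\<close>. Two observations decide the vertical velocity at
  the ends. For \<open>a = sqrt 3\<close> the growth of the angular momentum makes \<open>x / y\<close> decrease, which
  confines the orbit to a cone where the vertical acceleration is nonpositive, so it crosses with
  \<open>v \<le> 0\<close> (\<open>v_nonpos_if_narrow\<close>). For \<open>a = sqrt 63\<close> the energy is zero, and the Lagrange-Jacobi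
  identity makes the distance to the origin increase, so the orbit crosses with \<open>v > 0\<close>
  (\<open>v_pos_if_zero_energy\<close>). By continuity some \<open>a\<close> strictly below \<open>sqrt 63\<close> gives \<open>v = 0\<close>, and its
  energy is negative (\<open>perpendicular_crossing_exists\<close>).

  The continuity argument needs every orbit in between to reach the axis without a collision. This
  again follows from the angular momentum: at nonpositive energy its square is at most \<open>16 * r\<close>, so
  once it is positive, \<open>r\<close> stays away from \<open>0\<close>, and nonpositive energy also gives \<open>r \<le> 8 * y\<close>
  (\<open>r_lower\<close>, \<open>y_lower\<close>). These bounds are uniform in \<open>a\<close>. The acceleration may therefore be
  modified outside the region that they describe to become globally Lipschitz. For the modified
  system a contraction argument and Gronwall's inequality give solutions that exist on a fixed long
  time interval and depend continuously on \<open>a\<close>.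
\<close>

section \<open>Differential equations with a globally Lipschitz right-hand side\<close>

text \<open>
  Solutions are differentiable only within a closed time interval, one-sidedly at its ends. The
  qualitative arguments below all rest on this form of the mean value theorem.
\<close>

lemma mvt_within_interval:
  fixes f f' :: "real \<Rightarrow> real"
  assumes deriv: "\<And>t. t \<in> {0..T} \<Longrightarrow> (f has_real_derivative f' t) (at t within {0..T})"
    and "0 \<le> a" "a < b" "b \<le> T"
  obtains c where "a < c" "c < b" "f b - f a = (b - a) * f' c"
proof -
  have "\<exists>c\<in>{a<..<b}. f b - f a = f' c * (b - a)"
  proof (rule mvt_simple[OF \<open>a < b\<close>])
    show "(f has_derivative (*) (f' t)) (at t within {a..b})" if "a \<le> t" "t \<le> b" for t
      using has_derivative_subset[OF deriv[of t, unfolded has_field_derivative_def], of "{a..b}"] that assms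
      by auto
  qed
  then show thesis using that by (auto simp: mult.commute)
qed

lemma nondecreasing_within_interval:
  fixes f f' :: "real \<Rightarrow> real"
  assumes deriv: "\<And>t. t \<in> {0..T} \<Longrightarrow> (f has_real_derivative f' t) (at t within {0..T})"
    and nonneg: "\<And>t. t \<in> {0..T} \<Longrightarrow> f' t \<ge> 0"
    and "0 \<le> a" "a \<le> b" "b \<le> T"
  shows "f a \<le> f b"
proof (cases "a = b")
  case False
  obtain c where "a < c" "c < b" "f b - f a = (b - a) * f' c"
    by (rule mvt_within_interval[of T f f' a b]) (use deriv assms(3-) False in auto)
  moreover have "(b - a) * f' c \<ge> 0"
    using nonneg[of c] calculation assms(3-) by (intro mult_nonneg_nonneg) auto
  ultimately show ?thesis by linarith
qed simp

text \<open>
  Picard iteration on the whole interval at once. In the unknown \<open>g\<close> with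
  \<open>\<phi> t = z0 + exp (2 * L * t) *\<^sub>R g t\<close> the integral equation for \<open>\<phi>\<close> becomes a fixed point
  equation whose operator is a contraction with factor \<open>1/2\<close> in the supremum norm for every \<open>T\<close>,
  because integrating \<open>L * exp (2 * L * s)\<close> gains a factor \<open>1/2\<close>.
\<close>

lemma lipschitz_ode_solution_exists:
  fixes f :: "'a::banach \<Rightarrow> 'a"
  assumes lip: "\<And>z w. norm (f z - f w) \<le> L * norm (z - w)" and "L > 0" and "T \<ge> 0"
  shows "\<exists>\<phi>. \<phi> 0 = z0 \<and>
    (\<forall>t\<in>{0..T}. (\<phi> has_vector_derivative f (\<phi> t)) (at t within {0..T}))"
proof -
  define \<Phi> where "\<Phi> g t = z0 + exp (2 * L * t) *\<^sub>R apply_bcontfun g t"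
    for g :: "real \<Rightarrow>\<^sub>C 'a" and t
  define G where "G g t = exp (- (2 * L * t)) *\<^sub>R integral {0..t} (\<lambda>s. f (\<Phi> g s))"
    for g and t
  \<comment> \<open>Freezing time outside the interval makes the iterates bounded functions on the whole line.\<close>
  define cl where "cl t = max 0 (min T t)" for t :: real
  define P where "P g = Bcontfun (\<lambda>t. G g (cl t))" for g
  have f_cont: "continuous_on UNIV f"
    using lip \<open>L > 0\<close>
    by (intro lipschitz_on_continuous_on[of L]) (simp add: lipschitz_on_def dist_norm)
  have \<Phi>_cont: "continuous_on A (\<Phi> g)" for A g
    unfolding \<Phi>_def by (intro continuous_intros continuous_on_apply_bcontfun)
  have f\<Phi>_cont: "continuous_on A (\<lambda>s. f (\<Phi> g s))" for A g
    by (rule continuous_on_compose2[OF f_cont \<Phi>_cont]) auto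
  have G_cont: "continuous_on {0..T} (G g)" for g
    unfolding G_def
    by (intro continuous_intros indefinite_integral_continuous_1 integrable_continuous_real f\<Phi>_cont)
  have cl_mem: "cl t \<in> {0..T}" for t
    using \<open>T \<ge> 0\<close> by (auto simp: cl_def)
  have "(\<lambda>t. G g (cl t)) \<in> bcontfun" for g
  proof -
    have "continuous_on UNIV (\<lambda>t. G g (cl t))"
      by (rule continuous_on_compose2[OF G_cont]) (use cl_mem in \<open>auto simp: cl_def intro!: continuous_intros\<close>)
    moreover have "bounded (range (\<lambda>t. G g (cl t)))"
      by (rule bounded_subset[OF compact_imp_bounded[OF compact_continuous_image[OF G_cont]]])
        (use cl_mem in auto)
    ultimately show ?thesis by (simp add: bcontfun_def)
  qed
  then have P_apply: "apply_bcontfun (P g) t = G g (cl t)" for g t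
    by (simp add: P_def Bcontfun_inverse)
  have contraction: "dist (P g) (P h) \<le> 1/2 * dist g h" for g h
  proof (rule dist_bound)
    fix t'
    define t where "t = cl t'"
    have "t \<ge> 0" using cl_mem[of t'] by (simp add: t_def)
    have I: "((\<lambda>s. L * exp (2 * L * s) * dist g h) has_integral
        (exp (2 * L * t) * dist g h / 2 - exp (2 * L * 0) * dist g h / 2)) {0..t}"
      using \<open>t \<ge> 0\<close> by (intro fundamental_theorem_of_calculus)
        (auto intro!: derivative_eq_intros simp flip: has_real_derivative_iff_has_vector_derivative)
    have "norm (integral {0..t} (\<lambda>s. f (\<Phi> g s)) - integral {0..t} (\<lambda>s. f (\<Phi> h s)))
        = norm (integral {0..t} (\<lambda>s. f (\<Phi> g s) - f (\<Phi> h s)))"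
      by (subst integral_diff) (auto intro!: integrable_continuous_real f\<Phi>_cont)
    also have "\<dots> \<le> integral {0..t} (\<lambda>s. L * exp (2 * L * s) * dist g h)"
    proof (rule integral_norm_bound_integral)
      fix s assume "s \<in> {0..t}"
      have "norm (f (\<Phi> g s) - f (\<Phi> h s)) \<le> L * norm (\<Phi> g s - \<Phi> h s)" by (rule lip)
      also have "\<Phi> g s - \<Phi> h s = exp (2 * L * s) *\<^sub>R (apply_bcontfun g s - apply_bcontfun h s)"
        by (simp add: \<Phi>_def algebra_simps)
      also have "L * norm \<dots> \<le> L * (exp (2 * L * s) * dist g h)"
        using \<open>L > 0\<close> dist_bounded[of g s h] by (simp add: dist_norm)
      finally show "norm (f (\<Phi> g s) - f (\<Phi> h s)) \<le> L * exp (2 * L * s) * dist g h" by simp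
    qed (use I in \<open>auto intro!: integrable_continuous_real continuous_intros f\<Phi>_cont simp: has_integral_iff\<close>)
    also have "\<dots> \<le> exp (2 * L * t) * (dist g h / 2)"
      using I by (simp add: has_integral_iff)
    finally have bound: "norm (integral {0..t} (\<lambda>s. f (\<Phi> g s)) - integral {0..t} (\<lambda>s. f (\<Phi> h s)))
        \<le> exp (2 * L * t) * (dist g h / 2)" .
    have "dist (G g t) (G h t)
        = exp (- (2 * L * t)) * norm (integral {0..t} (\<lambda>s. f (\<Phi> g s)) - integral {0..t} (\<lambda>s. f (\<Phi> h s)))"
      by (simp add: G_def dist_norm flip: scaleR_right_diff_distrib)
    also have "\<dots> \<le> exp (- (2 * L * t)) * (exp (2 * L * t) * (dist g h / 2))"
      by (intro mult_left_mono bound) auto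
    also have "\<dots> = 1/2 * dist g h" by (simp add: exp_minus field_simps)
    finally show "dist (apply_bcontfun (P g) t') (apply_bcontfun (P h) t') \<le> 1/2 * dist g h"
      by (simp add: P_apply t_def)
  qed
  then obtain g where g: "P g = g"
    using banach_fix_type[of "1/2" P] by auto
  have int_eq: "\<Phi> g t = z0 + integral {0..t} (\<lambda>s. f (\<Phi> g s))" if "t \<in> {0..T}" for t
  proof -
    have "apply_bcontfun g t = G g t"
      using P_apply[of g t] that by (simp add: g cl_def)
    then show ?thesis by (simp add: \<Phi>_def[of g t] G_def flip: exp_add)
  qed
  have "(\<Phi> g has_vector_derivative f (\<Phi> g t)) (at t within {0..T})" if "t \<in> {0..T}" for t
  proof (rule has_vector_derivative_transform[OF that])
    show "((\<lambda>t. z0 + integral {0..t} (\<lambda>s. f (\<Phi> g s))) has_vector_derivative f (\<Phi> g t)) (at t within {0..T})"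
      using integral_has_vector_derivative[OF f\<Phi>_cont that]
      by (auto intro!: derivative_eq_intros)
  qed (use int_eq in auto)
  moreover have "\<Phi> g 0 = z0" using int_eq[of 0] \<open>T \<ge> 0\<close> by simp
  ultimately show ?thesis by blast
qed

text \<open>
  Gronwall's argument: the squared distance of two solutions, damped by \<open>exp (- 2 * L * t)\<close>, has
  a nonpositive derivative.
\<close>

lemma lipschitz_ode_dependence:
  fixes f :: "'a::real_inner \<Rightarrow> 'a"
  assumes lip: "\<And>z w. norm (f z - f w) \<le> L * norm (z - w)"
    and \<phi>: "\<And>t. t \<in> {0..T} \<Longrightarrow> (\<phi> has_vector_derivative f (\<phi> t)) (at t within {0..T})"
    and \<psi>: "\<And>t. t \<in> {0..T} \<Longrightarrow> (\<psi> has_vector_derivative f (\<psi> t)) (at t within {0..T})"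
    and t: "t \<in> {0..T}"
  shows "norm (\<phi> t - \<psi> t) \<le> exp (L * t) * norm (\<phi> 0 - \<psi> 0)"
proof -
  define d where "d s = \<phi> s - \<psi> s" for s
  define w where "w s = exp (- (2 * L * s)) * (d s \<bullet> d s)" for s
  have d_deriv: "(d has_vector_derivative f (\<phi> s) - f (\<psi> s)) (at s within {0..T})"
    if "s \<in> {0..T}" for s
    unfolding d_def using \<phi>[OF that] \<psi>[OF that] by (intro derivative_intros)
  define w' where "w' s = 2 * exp (- (2 * L * s)) * (d s \<bullet> (f (\<phi> s) - f (\<psi> s)) - L * (d s \<bullet> d s))" for s
  have w_deriv: "(w has_real_derivative w' s) (at s within {0..T})" if "s \<in> {0..T}" for s
  proof -
    have "((\<lambda>s. d s \<bullet> d s) has_vector_derivative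
        (d s \<bullet> (f (\<phi> s) - f (\<psi> s)) + (f (\<phi> s) - f (\<psi> s)) \<bullet> d s)) (at s within {0..T})"
      by (rule bounded_bilinear.has_vector_derivative[OF bounded_bilinear_inner d_deriv[OF that] d_deriv[OF that]])
    then have *: "((\<lambda>s. d s \<bullet> d s) has_real_derivative 2 * (d s \<bullet> (f (\<phi> s) - f (\<psi> s)))) (at s within {0..T})"
      by (simp add: has_real_derivative_iff_has_vector_derivative inner_commute)
    show ?thesis unfolding w_def w'_def
      by (rule derivative_eq_intros * refl | simp add: algebra_simps)+
  qed
  have w'_nonpos: "w' s \<le> 0" for s
  proof -
    have "d s \<bullet> (f (\<phi> s) - f (\<psi> s)) \<le> norm (d s) * norm (f (\<phi> s) - f (\<psi> s))"
      by (rule norm_cauchy_schwarz)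
    also have "\<dots> \<le> norm (d s) * (L * norm (d s))"
      unfolding d_def by (intro mult_left_mono lip) auto
    also have "\<dots> = L * (d s \<bullet> d s)" by (simp add: dot_square_norm power2_eq_square)
    finally show ?thesis by (simp add: w'_def mult_le_0_iff)
  qed
  have "w t \<le> w 0"
    using nondecreasing_within_interval[of T "\<lambda>s. - w s" "\<lambda>s. - w' s" 0 t] w_deriv w'_nonpos t
    by (auto intro!: derivative_intros)
  then have "exp (2 * L * t) * w t \<le> exp (2 * L * t) * w 0" by simp
  then have "(norm (d t))\<^sup>2 \<le> (exp (L * t) * norm (d 0))\<^sup>2"
    by (simp add: w_def dot_square_norm power_mult_distrib exp_minus flip: exp_double mult.assoc)
  then show ?thesis unfolding d_def by (rule power2_le_imp_le) simp
qed

section \<open>Brake orbits\<close>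

lemma powr_three_halves: "s \<ge> 0 \<Longrightarrow> s powr (3/2) = sqrt s ^ 3" for s :: real
proof -
  assume "s \<ge> 0"
  have "sqrt s ^ 3 = (s powr (1/2)) powr 3"
    using \<open>s \<ge> 0\<close> by (cases "s = 0") (simp_all add: powr_half_sqrt)
  then show ?thesis by (simp add: powr_powr)
qed

text \<open>
  A brake orbit starts at rest and is observed only while \<open>x\<close> is nonnegative. Its initial height is
  normalised to \<open>1\<close>, which scaling permits. At \<open>a = sqrt 63\<close> its energy is zero,
  for smaller \<open>a\<close> it is negative; at \<open>a = sqrt 3\<close> the initial vertical acceleration vanishes.
\<close>

locale brake_orbit =
  fixes a \<tau> :: real and x y u v :: "real \<Rightarrow> real"
  assumes system: "solves_langmuir_system {0..\<tau>} x y u v"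
    and init: "x 0 = a" "y 0 = 1" "u 0 = 0" "v 0 = 0"
    and a_bounds: "sqrt 3 \<le> a" "a \<le> sqrt 63"
    and \<tau>_nonneg: "0 \<le> \<tau>"
    and x_nonneg: "\<And>t. t \<in> {0..\<tau>} \<Longrightarrow> 0 \<le> x t"
begin

definition r where "r t = sqrt ((x t)\<^sup>2 + (y t)\<^sup>2)"

definition angmom where "angmom t = x t * v t - y t * u t"

lemma y_pos: "t \<in> {0..\<tau>} \<Longrightarrow> y t > 0"
  using system by (simp add: solves_langmuir_system_def)

lemma r_pos: "t \<in> {0..\<tau>} \<Longrightarrow> r t > 0"
  using y_pos[of t] by (simp add: r_def add_nonneg_pos)

lemma r_squared: "(r t)\<^sup>2 = (x t)\<^sup>2 + (y t)\<^sup>2"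
  by (simp add: r_def)

lemma
  assumes "t \<in> {0..\<tau>}"
  shows x_deriv: "(x has_real_derivative u t) (at t within {0..\<tau>})"
    and y_deriv: "(y has_real_derivative v t) (at t within {0..\<tau>})"
    and u_deriv: "(u has_real_derivative - 8 * x t / r t ^ 3) (at t within {0..\<tau>})"
    and v_deriv: "(v has_real_derivative - 8 * y t / r t ^ 3 + 1 / (y t)\<^sup>2) (at t within {0..\<tau>})"
  using system assms by (simp_all add: solves_langmuir_system_def r_def powr_three_halves)

lemma r_deriv:
  assumes "t \<in> {0..\<tau>}"
  shows "(r has_real_derivative (x t * u t + y t * v t) / r t) (at t within {0..\<tau>})"
proof -
  have "(x t)\<^sup>2 + (y t)\<^sup>2 > 0" using y_pos[OF assms] by (simp add: add_nonneg_pos)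
  then have "(r has_real_derivative (2 * (x t * u t + y t * v t)) * (inverse (r t) / 2)) (at t within {0..\<tau>})"
    unfolding r_def
    by (auto intro!: derivative_eq_intros x_deriv[OF assms] y_deriv[OF assms])
  moreover have "2 * k * (inverse s / 2) = k / s" for k s :: real
    by (simp add: field_simps)
  ultimately show ?thesis by metis
qed

lemma angmom_deriv:
  assumes "t \<in> {0..\<tau>}"
  shows "(angmom has_real_derivative x t / (y t)\<^sup>2) (at t within {0..\<tau>})"
  unfolding angmom_def
  by (auto intro!: derivative_eq_intros x_deriv[OF assms] y_deriv[OF assms] u_deriv[OF assms]
      v_deriv[OF assms] simp: field_simps)

lemma energy_conserved:
  assumes "t \<in> {0..\<tau>}"
  shows "((u t)\<^sup>2 + (v t)\<^sup>2) / 4 - 4 / r t + 1 / (2 * y t) = - 4 / sqrt (a\<^sup>2 + 1) + 1 / 2"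
proof (cases "t = 0")
  case False
  define H where "H t = ((u t)\<^sup>2 + (v t)\<^sup>2) / 4 - 4 / r t + 1 / (2 * y t)" for t
  have H_deriv: "(H has_real_derivative 0) (at s within {0..\<tau>})" if "s \<in> {0..\<tau>}" for s
  proof -
    note pos = y_pos[OF that] r_pos[OF that]
    show ?thesis unfolding H_def
      apply (rule derivative_eq_intros x_deriv[OF that] y_deriv[OF that] u_deriv[OF that]
          v_deriv[OF that] r_deriv[OF that] refl | use pos in force)+
      using pos by (simp add: field_simps power2_eq_square power3_eq_cube)
  qed
  have "H t - H 0 = (t - 0) * 0"
    by (rule mvt_within_interval[of \<tau> H "\<lambda>_. 0" 0 t]) (use H_deriv assms False in auto)
  then show ?thesis by (simp add: H_def r_def init)
qed (simp add: r_def init)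

text \<open>
  The left-hand side is the energy at the starting point, where the distance to the origin is at
  most \<open>8\<close>.
\<close>

lemma energy_nonpos: "- 4 / sqrt (a\<^sup>2 + 1) + 1 / 2 \<le> 0"
proof -
  have "a \<ge> 0" using a_bounds(1) by (rule order_trans[rotated]) simp
  then have "a\<^sup>2 \<le> (sqrt 63)\<^sup>2" using a_bounds(2) by (intro power_mono)
  then have "a\<^sup>2 \<le> 63" by simp
  then have "sqrt (a\<^sup>2 + 1) \<le> 8" by (intro real_le_lsqrt) auto
  moreover have "sqrt (a\<^sup>2 + 1) > 0" by (simp add: add_nonneg_pos)
  ultimately show ?thesis by (simp add: field_simps)
qed

text \<open>
  Nonpositive energy leaves only the cone \<open>r \<le> 8 * y\<close> accessible. On this cone the
  singularity at \<open>y = 0\<close> can be reached only at the origin.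
\<close>

lemma
  assumes t: "t \<in> {0..\<tau>}"
  shows speed_bound: "(u t)\<^sup>2 + (v t)\<^sup>2 \<le> 16 / r t" and y_ge_r: "r t / 8 \<le> y t"
proof -
  define K where "K = (u t)\<^sup>2 + (v t)\<^sup>2"
  define p q where "p = 1 / r t" and "q = 1 / (2 * y t)"
  have "K / 4 - 4 * p + q \<le> 0"
    using energy_conserved[OF t] energy_nonpos by (simp add: K_def p_def q_def)
  moreover have "K \<ge> 0" "q \<ge> 0" using y_pos[OF t] by (auto simp: K_def q_def)
  ultimately have "K \<le> 16 * p" "q \<le> 4 * p" by linarith+
  then show "(u t)\<^sup>2 + (v t)\<^sup>2 \<le> 16 / r t" "r t / 8 \<le> y t"
    using y_pos[OF t] r_pos[OF t] by (simp_all add: K_def p_def q_def field_simps)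
qed

lemma u_nonincreasing: "0 \<le> s \<Longrightarrow> s \<le> t \<Longrightarrow> t \<le> \<tau> \<Longrightarrow> u t \<le> u s"
proof -
  assume st: "0 \<le> s" "s \<le> t" "t \<le> \<tau>"
  have "- u s \<le> - u t"
    by (rule nondecreasing_within_interval[of \<tau> _ "\<lambda>t. 8 * x t / r t ^ 3"])
      (use st x_nonneg r_pos in \<open>auto intro!: derivative_eq_intros u_deriv divide_nonneg_pos\<close>)
  then show ?thesis by simp
qed

lemma u_nonpos: "t \<in> {0..\<tau>} \<Longrightarrow> u t \<le> 0"
  using u_nonincreasing[of 0 t] init by simp

lemma x_nonincreasing: "0 \<le> s \<Longrightarrow> s \<le> t \<Longrightarrow> t \<le> \<tau> \<Longrightarrow> x t \<le> x s"
proof -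
  assume st: "0 \<le> s" "s \<le> t" "t \<le> \<tau>"
  have "- x s \<le> - x t"
    by (rule nondecreasing_within_interval[of \<tau> _ "\<lambda>t. - u t"])
      (use st u_nonpos in \<open>auto intro!: derivative_intros x_deriv\<close>)
  then show ?thesis by simp
qed

text \<open>
  The repulsion between the electrons is vertical, so for \<open>x \<ge> 0\<close> it exerts a torque of constant
  sign, while the central attraction exerts none.
\<close>

lemma angmom_nondecreasing: "0 \<le> s \<Longrightarrow> s \<le> t \<Longrightarrow> t \<le> \<tau> \<Longrightarrow> angmom s \<le> angmom t"
  by (rule nondecreasing_within_interval[of \<tau> _ "\<lambda>t. x t / (y t)\<^sup>2"])
    (use x_nonneg angmom_deriv in auto)

lemma angmom_nonneg: "t \<in> {0..\<tau>} \<Longrightarrow> 0 \<le> angmom t"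
  using angmom_nondecreasing[of 0 t] by (simp add: angmom_def init)

text \<open>
  The Cauchy-Schwarz inequality and the bound on the speed. Since the angular momentum grows, this
  keeps the orbit away from the origin.
\<close>

lemma angmom_squared_le: 
  assumes t: "t \<in> {0..\<tau>}"
  shows "(angmom t)\<^sup>2 \<le> 16 * r t"
proof -
  have "(angmom t)\<^sup>2 + (x t * u t + y t * v t)\<^sup>2 = (r t)\<^sup>2 * ((u t)\<^sup>2 + (v t)\<^sup>2)"
    unfolding r_squared angmom_def by algebra
  then have "(angmom t)\<^sup>2 \<le> (r t)\<^sup>2 * ((u t)\<^sup>2 + (v t)\<^sup>2)"
    using zero_le_power2[of "x t * u t + y t * v t"] by linarith
  also have "\<dots> \<le> (r t)\<^sup>2 * (16 / r t)"
    by (intro mult_left_mono speed_bound t) auto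
  finally show ?thesis using r_pos[OF t] by (simp add: power2_eq_square)
qed

lemma x_le_r: "x t \<le> r t"
  by (auto simp: r_def intro!: real_le_rsqrt)

lemma speed_le_4:
  assumes "t \<in> {0..\<tau>}" "1 \<le> x t"
  shows "- 4 \<le> u t" "v t \<le> 4"
proof -
  have "r t \<ge> 1" using x_le_r[of t] assms by simp
  then have "16 / r t \<le> 16" by (simp add: field_simps)
  then have "(u t)\<^sup>2 + (v t)\<^sup>2 \<le> 4\<^sup>2" using speed_bound[OF assms(1)] by simp
  then have "(u t)\<^sup>2 \<le> 4\<^sup>2" "(v t)\<^sup>2 \<le> 4\<^sup>2"
    using zero_le_power2[of "u t"] zero_le_power2[of "v t"] by linarith+
  then have "\<bar>u t\<bar> \<le> 4" "\<bar>v t\<bar> \<le> 4" by (simp_all add: abs_le_square_iff[of _ 4, simplified])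
  then show "- 4 \<le> u t" "v t \<le> 4" by auto
qed

lemma x_continuous: "continuous_on {0..\<tau>} x"
  using x_deriv by (intro DERIV_continuous_on)

text \<open>
  Up to time \<open>1/10\<close> the orbit cannot leave the region \<open>x \<ge> 1\<close>: there its speed is at most \<open>4\<close>, and it
  starts at a distance of at least \<open>0.7\<close> from the line \<open>x = 1\<close>.
\<close>

lemma x_ge_1_early:
  assumes t: "0 \<le> t" "t \<le> \<tau>" "t \<le> 1/10"
  shows "1 \<le> x t"
proof (rule ccontr)
  assume "\<not> 1 \<le> x t"
  have "sqrt 3 \<ge> 1.7" by (intro real_le_rsqrt) (simp add: power2_eq_square)
  then have "a \<ge> 1.7" using a_bounds by simp
  obtain b where b: "0 \<le> b" "b \<le> t" "x b = 1"
    using IVT2'[of x t 1 0] \<open>\<not> 1 \<le> x t\<close> \<open>a \<ge> 1.7\<close> init t continuous_on_subset[OF x_continuous, of "{0..t}"]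
    by auto
  then have "b > 0" using \<open>a \<ge> 1.7\<close> init by (cases "b = 0") auto
  obtain c where c: "0 < c" "c < b" "x b - x 0 = (b - 0) * u c"
    by (rule mvt_within_interval[of \<tau> x u 0 b]) (use b t \<open>b > 0\<close> x_deriv in auto)
  have "x c \<ge> 1" using x_nonincreasing[of c b] b c t by simp
  then have "- 4 \<le> u c" using speed_le_4(1)[of c] b c t by simp
  then have "b * (- 4) \<le> b * u c" using b by (intro mult_left_mono) auto
  then show False using c b t init \<open>a \<ge> 1.7\<close> by simp
qed

lemma y_le_2_early:
  assumes t: "0 \<le> t" "t \<le> \<tau>" "t \<le> 1/10"
  shows "y t \<le> 2"
proof (cases "t = 0")
  case False
  obtain c where c: "0 < c" "c < t" "y t - y 0 = (t - 0) * v c"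
    by (rule mvt_within_interval[of \<tau> y v 0 t]) (use t False y_deriv in auto)
  have "v c \<le> 4" using speed_le_4(2)[of c] x_ge_1_early[of c] t c by simp
  then have "t * v c \<le> t * 4" using t by (intro mult_left_mono) auto
  then have "y t - y 0 \<le> t * 4" using c by simp
  then show ?thesis using init t by linarith
qed (simp add: init)

text \<open>
  During this first period the torque \<open>x / y\<^sup>2\<close> is at least \<open>1/4\<close>, which produces an angular
  momentum that is never lost.
\<close>

lemma angmom_kick:
  assumes "1/10 \<le> t" "t \<le> \<tau>"
  shows "angmom t \<ge> 1/40"
proof -
  obtain c where c: "0 < c" "c < 1/10" "angmom (1/10) - angmom 0 = (1/10 - 0) * (x c / (y c)\<^sup>2)"
    by (rule mvt_within_interval[of \<tau> angmom "\<lambda>t. x t / (y t)\<^sup>2" 0 "1/10"]) (use assms angmom_deriv in auto)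
  have "1 \<le> x c" "0 < y c" "y c \<le> 2" using x_ge_1_early[of c] y_pos[of c] y_le_2_early[of c] c assms by auto
  then have "(y c)\<^sup>2 \<le> 2\<^sup>2" by (intro power_mono) auto
  then have "1 / 4 \<le> x c / (y c)\<^sup>2" using \<open>1 \<le> x c\<close> \<open>0 < y c\<close> by (intro frac_le) auto
  then have "(1/10 - 0) * (1/4) \<le> angmom (1/10) - angmom 0"
    unfolding c(3) by (intro mult_left_mono) auto
  then have "1 / 40 \<le> angmom (1/10)" by (simp add: angmom_def init)
  then show ?thesis using angmom_nondecreasing[of "1/10" t] assms by simp
qed

lemma x_le_8: "t \<in> {0..\<tau>} \<Longrightarrow> x t \<le> 8"
proof -
  have "sqrt 63 \<le> 8" by (intro real_le_lsqrt) auto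
  then show "t \<in> {0..\<tau>} \<Longrightarrow> x t \<le> 8" using x_nonincreasing[of 0 t] init a_bounds by auto
qed

text \<open>
  In the early period the orbit stays in the disk \<open>r \<le> 8 + 2\<close> with \<open>x \<ge> 1\<close>, so the horizontal
  deceleration is at least \<open>8 / 10 ^ 3\<close>.
\<close>

lemma u_early:
  assumes "0 < t" "t \<le> 1/10" "t \<le> \<tau>"
  shows "u t \<le> t * (- 8 / 1000)"
proof -
  obtain c where c: "0 < c" "c < t" "u t - u 0 = (t - 0) * (- 8 * x c / r c ^ 3)"
    by (rule mvt_within_interval[of \<tau> u "\<lambda>t. - 8 * x t / r t ^ 3" 0 t]) (use assms u_deriv in auto)
  have mem: "c \<in> {0..\<tau>}" using c assms by simp
  have 1: "1 \<le> x c" "y c \<le> 2" using x_ge_1_early[of c] y_le_2_early[of c] c assms by auto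
  have "r c \<le> 10" unfolding r_def
    using sqrt_sum_squares_le_sum[of "x c" "y c"] 1 x_le_8[OF mem] y_pos[OF mem] by simp
  then have "r c ^ 3 \<le> 10 ^ 3" using r_pos[OF mem] by (intro power_mono) auto
  then have "8 / 1000 \<le> 8 * x c / r c ^ 3" using 1 r_pos[OF mem] by (intro frac_le) auto
  then have "t * (8 / 1000) \<le> t * (8 * x c / r c ^ 3)" using assms by (intro mult_left_mono) auto
  then show ?thesis using c init by simp
qed

lemma u_neg:
  assumes "0 < t" "t \<le> \<tau>"
  shows "u t < 0"
proof -
  have "u (min t (1/10)) \<le> min t (1/10) * (- 8 / 1000)" using assms by (intro u_early) auto
  also have "\<dots> < 0" using assms by simp
  finally show ?thesis using u_nonincreasing[of "min t (1/10)" t] assms by simp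
qed

text \<open>
  No triple collision: early on \<open>r \<ge> x \<ge> 1\<close>, and afterwards the angular momentum forces
  \<open>r \<ge> (1/40)\<^sup>2 / 16\<close>.
\<close>

lemma r_lower: 
  assumes t: "t \<in> {0..\<tau>}" 
  shows "1 / 25600 \<le> r t"
proof (cases "t \<le> 1/10")
  case True
  then show ?thesis using x_ge_1_early[of t] x_le_r[of t] t by simp
next
  case False
  then have "angmom t \<ge> 1/40" using angmom_kick[of t] t by simp
  then have "(1/40)\<^sup>2 \<le> (angmom t)\<^sup>2" by (intro power_mono) auto
  then show ?thesis using angmom_squared_le[OF t] by (simp add: power2_eq_square)
qed

lemma y_lower: "t \<in> {0..\<tau>} \<Longrightarrow> 1 / 204800 \<le> y t"
  using r_lower[of t] y_ge_r[of t] by simp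

text \<open>
  Being concave, \<open>x\<close> decreases at least at the rate that it has reached at time \<open>1/10\<close>, so it cannot
  stay nonnegative for long.
\<close>

lemma \<tau>_upper: "\<tau> \<le> 20000"
proof (cases "\<tau> \<le> 1/10")
  case False
  obtain c where c: "1/10 < c" "c < \<tau>" "x \<tau> - x (1/10) = (\<tau> - 1/10) * u c"
    by (rule mvt_within_interval[of \<tau> x u "1/10" \<tau>]) (use False x_deriv in auto)
  have "u c \<le> 1/10 * (- 8 / 1000)"
    using u_early[of "1/10"] u_nonincreasing[of "1/10" c] c by simp
  then have "(\<tau> - 1/10) * u c \<le> (\<tau> - 1/10) * (1/10 * (- 8 / 1000))"
    using False by (intro mult_left_mono) auto
  then have "x \<tau> - x (1/10) \<le> (\<tau> - 1/10) * (1/10 * (- 8 / 1000))" by (simp only: c(3))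
  then have "x \<tau> - x (1/10) \<le> 1/12500 - \<tau> / 1250" by (simp add: field_simps)
  moreover have "0 \<le> x \<tau>" "x (1/10) \<le> 8" using x_nonneg x_le_8 False by auto
  ultimately show ?thesis by linarith
qed simp

text \<open>
  The slope \<open>x / y\<close> has derivative \<open>- angmom / y\<^sup>2\<close>, so it never exceeds its initial value \<open>sqrt 3\<close>.
  In the cone \<open>x \<le> sqrt 3 * y\<close>, that is \<open>r \<le> 2 * y\<close>, the attraction of the nucleus dominates the
  vertical repulsion.
\<close>

lemma v_nonpos_if_narrow:
  assumes "a = sqrt 3"
  shows "v \<tau> \<le> 0"
proof -
  have narrow: "x t \<le> sqrt 3 * y t" if t: "t \<in> {0..\<tau>}" for t
  proof -
    have deriv: "((\<lambda>t. - (x t / y t)) has_real_derivative angmom s / (y s)\<^sup>2) (at s within {0..\<tau>})"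
      if "s \<in> {0..\<tau>}" for s
      using y_pos[OF that] unfolding angmom_def
      by (auto intro!: derivative_eq_intros x_deriv[OF that] y_deriv[OF that] simp: field_simps power2_eq_square)
    have "- (x 0 / y 0) \<le> - (x t / y t)"
      by (rule nondecreasing_within_interval[OF deriv]) (use t angmom_nonneg in auto)
    then show ?thesis using y_pos[OF t] by (simp add: init assms field_simps)
  qed
  have "8 * y t / r t ^ 3 \<ge> 1 / (y t)\<^sup>2" if t: "t \<in> {0..\<tau>}" for t
  proof -
    have "(x t)\<^sup>2 \<le> (sqrt 3 * y t)\<^sup>2" using narrow[OF t] x_nonneg[OF t] by (intro power_mono) auto
    then have "(r t)\<^sup>2 \<le> (2 * y t)\<^sup>2" by (simp add: r_squared power_mult_distrib)
    then have "r t \<le> 2 * y t" by (rule power2_le_imp_le) (use y_pos[OF t] in simp)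
    then have "r t ^ 3 \<le> (2 * y t) ^ 3" using r_pos[OF t] by (intro power_mono) auto
    then have "8 * y t / (2 * y t) ^ 3 \<le> 8 * y t / r t ^ 3"
      using y_pos[OF t] r_pos[OF t] by (intro divide_left_mono) auto
    then show ?thesis using y_pos[OF t] by (simp add: power2_eq_square power3_eq_cube)
  qed
  then have "- v 0 \<le> - v \<tau>"
    by (intro nondecreasing_within_interval[of \<tau> "\<lambda>t. - v t" "\<lambda>t. 8 * y t / r t ^ 3 - 1 / (y t)\<^sup>2"])
      (auto intro!: derivative_eq_intros v_deriv simp: \<tau>_nonneg)
  then show ?thesis by (simp add: init)
qed

text \<open>
  At zero energy the Lagrange-Jacobi identity says that \<open>x * u + y * v\<close>, half the derivative of
  \<open>r\<^sup>2\<close>, has the derivative \<open>(u\<^sup>2 + v\<^sup>2) / 2\<close>. It starts from \<open>0\<close>, and on the axis it equals \<open>y * v\<close>.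
\<close>

lemma v_pos_if_zero_energy:
  assumes "a = sqrt 63" "0 < \<tau>" "x \<tau> = 0"
  shows "0 < v \<tau>"
proof -
  have deriv: "((\<lambda>t. x t * u t + y t * v t) has_real_derivative ((u t)\<^sup>2 + (v t)\<^sup>2) / 2) (at t within {0..\<tau>})"
    if t: "t \<in> {0..\<tau>}" for t
  proof -
    have "sqrt 64 = (8::real)" by (simp add: real_sqrt_unique)
    then have 1: "(u t)\<^sup>2 + (v t)\<^sup>2 = 16 / r t - 2 / y t"
      using energy_conserved[OF t] by (simp add: assms field_simps)
    have "8 * (x t)\<^sup>2 / r t ^ 3 + 8 * (y t)\<^sup>2 / r t ^ 3 = 8 * (r t)\<^sup>2 / r t ^ 3"
      by (simp add: r_squared add_divide_distrib distrib_left)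
    also have "\<dots> = 8 / r t" using r_pos[OF t] by (simp add: power2_eq_square power3_eq_cube)
    finally have 2: "x t * (8 * x t / r t ^ 3) + y t * (8 * y t / r t ^ 3) = 8 / r t"
      by (simp add: power2_eq_square algebra_simps)
    have 3: "y t * (1 / (y t)\<^sup>2) = 1 / y t" by (simp add: power2_eq_square)
    have "u t * u t + x t * (- 8 * x t / r t ^ 3) + (v t * v t + y t * (- 8 * y t / r t ^ 3 + 1 / (y t)\<^sup>2))
       = (u t)\<^sup>2 + (v t)\<^sup>2 - 8 / r t + 1 / y t"
      using 2 3 by (simp add: power2_eq_square algebra_simps)
    also have "\<dots> = ((u t)\<^sup>2 + (v t)\<^sup>2) / 2" unfolding 1 by (simp add: field_simps)
    finally show ?thesis
      by (auto intro!: derivative_eq_intros x_deriv[OF t] y_deriv[OF t] u_deriv[OF t] v_deriv[OF t]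
          simp: algebra_simps)
  qed
  obtain c where c: "0 < c" "c < \<tau>"
    "(x \<tau> * u \<tau> + y \<tau> * v \<tau>) - (x 0 * u 0 + y 0 * v 0) = (\<tau> - 0) * (((u c)\<^sup>2 + (v c)\<^sup>2) / 2)"
    by (rule mvt_within_interval[OF deriv, of 0 \<tau>]) (use assms in auto)
  have "(u c)\<^sup>2 > 0" using u_neg[of c] c by simp
  then have "0 < (\<tau> - 0) * (((u c)\<^sup>2 + (v c)\<^sup>2) / 2)"
    using \<open>0 < \<tau>\<close> by (intro mult_pos_pos divide_pos_pos add_pos_nonneg) auto
  then have "0 < y \<tau> * v \<tau>" using c by (simp add: init assms)
  then show ?thesis using y_pos[of \<tau>] assms by (simp add: zero_less_mult_iff)
qed

end

section \<open>A globally Lipschitz modification of the system\<close>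

text \<open>
  The inversion \<open>q \<mapsto> q / (norm q)\<^sup>2\<close> multiplies the distance of \<open>p\<close> and \<open>q\<close> by
  \<open>1 / (norm p * norm q)\<close>. The field is the product of this map with \<open>1 / norm q\<close>, and both factors are
  bounded and Lipschitz away from the origin. In dimension one the same estimate controls the
  repulsion \<open>1 / y\<^sup>2\<close>.
\<close>

lemma inverse_square_law_lipschitz:
  fixes p q :: "'a::real_inner"
  assumes "0 < \<eta>" "\<eta> \<le> norm p" "\<eta> \<le> norm q"
  shows "norm (q /\<^sub>R norm q ^ 3 - p /\<^sub>R norm p ^ 3) \<le> 2 / \<eta> ^ 3 * norm (q - p)"
proof -
  define b c where "b = inverse (norm q)" and "c = inverse (norm p)"
  have pos: "norm p > 0" "norm q > 0" using assms by linarith+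
  have b: "0 < b" "b \<le> inverse \<eta>" and c: "0 < c" "c \<le> inverse \<eta>"
    using assms pos unfolding b_def c_def by (simp_all only: positive_imp_inverse_positive le_imp_inverse_le)
  have bq: "b * norm q = 1" and cp: "c * norm p = 1" using pos by (auto simp: b_def c_def)
  have inversion: "norm (b\<^sup>2 *\<^sub>R q - c\<^sup>2 *\<^sub>R p) = b * c * norm (q - p)"
  proof (rule power2_eq_imp_eq)
    have norm_diff: "(norm (s - t))\<^sup>2 = (norm s)\<^sup>2 - 2 * (s \<bullet> t) + (norm t)\<^sup>2" for s t :: 'a
      by (simp add: power2_norm_eq_inner inner_diff inner_commute algebra_simps)
    have "(norm (b\<^sup>2 *\<^sub>R q - c\<^sup>2 *\<^sub>R p))\<^sup>2
        = b\<^sup>2 * (b * norm q)\<^sup>2 - 2 * b\<^sup>2 * c\<^sup>2 * (q \<bullet> p) + c\<^sup>2 * (c * norm p)\<^sup>2"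
      unfolding norm_diff by (simp add: power_mult_distrib power2_eq_square)
    also have "\<dots> = b\<^sup>2 * (c * norm p)\<^sup>2 - 2 * b\<^sup>2 * c\<^sup>2 * (q \<bullet> p) + c\<^sup>2 * (b * norm q)\<^sup>2"
      by (simp add: bq cp)
    also have "\<dots> = (b * c * norm (q - p))\<^sup>2"
      unfolding power_mult_distrib norm_diff by (simp add: algebra_simps)
    finally show "(norm (b\<^sup>2 *\<^sub>R q - c\<^sup>2 *\<^sub>R p))\<^sup>2 = (b * c * norm (q - p))\<^sup>2" .
  qed (use b c in auto)
  have "b - c = b * (c * norm p) - c * (b * norm q)" by (simp add: bq cp)
  also have "\<dots> = (b * c) * (norm p - norm q)" by (simp add: algebra_simps)
  finally have "\<bar>b - c\<bar> = (b * c) * \<bar>norm p - norm q\<bar>" using b c by (simp add: abs_mult)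
  also have "\<dots> \<le> (b * c) * norm (q - p)"
    using b c norm_triangle_ineq3[of q p] by (intro mult_left_mono) auto
  finally have bc: "\<bar>b - c\<bar> \<le> (b * c) * norm (q - p)" .
  have "q /\<^sub>R norm q ^ 3 - p /\<^sub>R norm p ^ 3 = b ^ 3 *\<^sub>R q - c ^ 3 *\<^sub>R p"
    by (simp add: b_def c_def power_inverse)
  also have "\<dots> = b *\<^sub>R (b\<^sup>2 *\<^sub>R q - c\<^sup>2 *\<^sub>R p) + ((b - c) * c\<^sup>2) *\<^sub>R p"
    by (simp add: algebra_simps power2_eq_square power3_eq_cube)
  also have "norm \<dots> \<le> norm (b *\<^sub>R (b\<^sup>2 *\<^sub>R q - c\<^sup>2 *\<^sub>R p)) + norm (((b - c) * c\<^sup>2) *\<^sub>R p)"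
    by (rule norm_triangle_ineq)
  also have "norm (((b - c) * c\<^sup>2) *\<^sub>R p) = \<bar>b - c\<bar> * (c * (c * norm p))"
    using c by (simp add: abs_mult power2_eq_square)
  also have "norm (b *\<^sub>R (b\<^sup>2 *\<^sub>R q - c\<^sup>2 *\<^sub>R p)) = b * (b * c * norm (q - p))"
    using b by (simp add: inversion)
  also have "b * (b * c * norm (q - p)) + \<bar>b - c\<bar> * (c * (c * norm p))
      \<le> b * (b * c * norm (q - p)) + (b * c) * norm (q - p) * c"
    unfolding cp using bc c by (intro add_left_mono mult_mono) auto
  also have "\<dots> = (b * b * c + b * c * c) * norm (q - p)" by (simp add: algebra_simps)
  also have "\<dots> \<le> (inverse \<eta> * inverse \<eta> * inverse \<eta> + inverse \<eta> * inverse \<eta> * inverse \<eta>) * norm (q - p)"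
    using b c assms(1) by (intro mult_right_mono add_mono mult_mono) auto
  also have "\<dots> = 2 / \<eta> ^ 3 * norm (q - p)"
    using assms(1) by (simp add: power3_eq_cube field_simps)
  finally show ?thesis .
qed

text \<open>
  A pair of the position \<open>(x, y)\<close> and the velocity \<open>(u, v)\<close>.
\<close>

type_synonym phase_point = "(real \<times> real) \<times> (real \<times> real)"

definition langmuir_accel :: "real \<times> real \<Rightarrow> real \<times> real"
  where "langmuir_accel q =
    (- 8 * fst q / norm q ^ 3, - 8 * snd q / norm q ^ 3 + 1 / (snd q)\<^sup>2)"

text \<open>
  Below the bound \<open>1 / 204800\<close> of \<open>y\<close> along brake orbits, so that clipping never acts on them.
\<close>

definition height_floor :: real where "height_floor = 1 / 10 ^ 6"

text \<open>
  Clipping \<open>x\<close> at \<open>0\<close> keeps \<open>x\<close> concave, hence decreasing, also beyond the crossing of the axis; this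
  makes the crossing time unique. Clipping \<open>y\<close> removes the singularities.
\<close>

definition clip :: "real \<times> real \<Rightarrow> real \<times> real"
  where "clip q = (max 0 (fst q), max height_floor (snd q))"

definition clipped_field :: "phase_point \<Rightarrow> phase_point"
  where "clipped_field z = (snd z, langmuir_accel (clip (fst z)))"

text \<open>
  Beyond the time \<open>20000\<close> at which every brake orbit has crossed the axis.
\<close>

definition horizon :: real where "horizon = 20001"

text \<open>
  The constant combines the Lipschitz constants \<open>18 / height_floor ^ 3\<close> of the acceleration, \<open>2\<close> of
  clipping and \<open>1\<close> of the velocity component.
\<close>

definition clipped_lipschitz :: real
  where "clipped_lipschitz = 1 + 36 / height_floor ^ 3"

lemma norm_fst_le_norm: "norm (fst z) \<le> norm z" and norm_snd_le_norm: "norm (snd z) \<le> norm z"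
  by (metis norm_fst_le prod.collapse) (metis norm_snd_le prod.collapse)

lemma height_floor_pos: "0 < height_floor"
  by (simp add: height_floor_def)

lemma langmuir_accel_lipschitz:
  assumes "height_floor \<le> snd p" "height_floor \<le> snd q"
  shows "norm (langmuir_accel q - langmuir_accel p) \<le> 18 / height_floor ^ 3 * norm (q - p)"
proof -
  have "norm (q /\<^sub>R norm q ^ 3 - p /\<^sub>R norm p ^ 3) \<le> 2 / height_floor ^ 3 * norm (q - p)"
    using assms norm_snd_le[of "snd p" "fst p"] norm_snd_le[of "snd q" "fst q"]
    by (intro inverse_square_law_lipschitz height_floor_pos) auto
  moreover have "norm (1 / (snd q)\<^sup>2 - 1 / (snd p)\<^sup>2) \<le> 2 / height_floor ^ 3 * norm (q - p)"
  proof -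
    have cube: "s /\<^sub>R norm s ^ 3 = 1 / s\<^sup>2" if "height_floor \<le> s" for s :: real
    proof -
      have "s > 0" using that height_floor_pos by linarith
      then show ?thesis by (simp add: power2_eq_square power3_eq_cube inverse_eq_divide)
    qed
    have "norm (snd q /\<^sub>R norm (snd q) ^ 3 - snd p /\<^sub>R norm (snd p) ^ 3)
        \<le> 2 / height_floor ^ 3 * norm (snd q - snd p)"
      using assms height_floor_pos by (intro inverse_square_law_lipschitz) auto
    also have "\<dots> \<le> 2 / height_floor ^ 3 * norm (q - p)"
      unfolding snd_diff[symmetric] using height_floor_pos by (intro mult_left_mono norm_snd_le_norm) auto
    finally show ?thesis by (simp only: cube[OF assms(1)] cube[OF assms(2)])
  qed
  moreover have "norm (langmuir_accel q - langmuir_accel p)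
      \<le> norm (1 / (snd q)\<^sup>2 - 1 / (snd p)\<^sup>2) + 8 * norm (q /\<^sub>R norm q ^ 3 - p /\<^sub>R norm p ^ 3)"
  proof -
    have "langmuir_accel q - langmuir_accel p
        = (0, 1 / (snd q)\<^sup>2 - 1 / (snd p)\<^sup>2) - 8 *\<^sub>R (q /\<^sub>R norm q ^ 3 - p /\<^sub>R norm p ^ 3)"
      by (simp add: langmuir_accel_def algebra_simps inverse_eq_divide prod_eq_iff)
    also have "norm \<dots> \<le> norm ((0::real), 1 / (snd q)\<^sup>2 - 1 / (snd p)\<^sup>2)
        + norm (8 *\<^sub>R (q /\<^sub>R norm q ^ 3 - p /\<^sub>R norm p ^ 3))"
      by (rule norm_triangle_ineq4)
    finally show ?thesis by (simp add: norm_Pair)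
  qed
  ultimately show ?thesis by linarith
qed

lemma clip_lipschitz: "norm (clip q - clip p) \<le> 2 * norm (q - p)"
proof -
  have "norm (clip q - clip p) \<le> norm (max 0 (fst q) - max 0 (fst p))
      + norm (max height_floor (snd q) - max height_floor (snd p))"
    unfolding clip_def diff_Pair by (rule norm_Pair_le)
  also have "\<dots> \<le> norm (fst (q - p)) + norm (snd (q - p))"
    by (auto simp: max_def)
  also have "\<dots> \<le> norm (q - p) + norm (q - p)"
    by (intro add_mono norm_fst_le_norm norm_snd_le_norm)
  finally show ?thesis by simp
qed

lemma clipped_field_lipschitz:
  "norm (clipped_field z - clipped_field w) \<le> clipped_lipschitz * norm (z - w)"
proof -
  have "norm (clipped_field z - clipped_field w)
      \<le> norm (snd (z - w)) + norm (langmuir_accel (clip (fst z)) - langmuir_accel (clip (fst w)))"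
    unfolding clipped_field_def diff_Pair snd_diff by (rule norm_Pair_le)
  also have "\<dots> \<le> norm (z - w) + 18 / height_floor ^ 3 * (2 * norm (z - w))"
  proof (intro add_mono)
    show "norm (snd (z - w)) \<le> norm (z - w)"
      by (rule norm_snd_le_norm)
    have "norm (langmuir_accel (clip (fst z)) - langmuir_accel (clip (fst w)))
        \<le> 18 / height_floor ^ 3 * norm (clip (fst z) - clip (fst w))"
      by (rule langmuir_accel_lipschitz) (auto simp: clip_def)
    also have "\<dots> \<le> 18 / height_floor ^ 3 * (2 * norm (z - w))"
    proof (intro mult_left_mono)
      have "norm (fst (z - w)) \<le> norm (z - w)" by (rule norm_fst_le_norm)
      then show "norm (clip (fst z) - clip (fst w)) \<le> 2 * norm (z - w)"
        using clip_lipschitz[of "fst z" "fst w"] by simp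
    qed (simp add: height_floor_def)
    finally show "norm (langmuir_accel (clip (fst z)) - langmuir_accel (clip (fst w)))
        \<le> 18 / height_floor ^ 3 * (2 * norm (z - w))" .
  qed
  also have "\<dots> = clipped_lipschitz * norm (z - w)"
    by (simp add: clipped_lipschitz_def algebra_simps)
  finally show ?thesis .
qed

locale clipped_orbit =
  fixes a :: real and \<phi> :: "real \<Rightarrow> phase_point"
  assumes a_bounds: "sqrt 3 \<le> a" "a \<le> sqrt 63"
    and initial: "\<phi> 0 = ((a, 1), (0, 0))"
    and \<phi>_deriv: "\<And>t. t \<in> {0..horizon} \<Longrightarrow>
      (\<phi> has_vector_derivative clipped_field (\<phi> t)) (at t within {0..horizon})"
begin

definition x where "x t = fst (fst (\<phi> t))"
definition y where "y t = snd (fst (\<phi> t))"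
definition u where "u t = fst (snd (\<phi> t))"
definition v where "v t = snd (snd (\<phi> t))"

lemma
  assumes t: "t \<in> {0..horizon}"
  shows x_deriv: "(x has_real_derivative u t) (at t within {0..horizon})"
    and y_deriv: "(y has_real_derivative v t) (at t within {0..horizon})"
    and u_deriv: "(u has_real_derivative fst (langmuir_accel (clip (x t, y t)))) (at t within {0..horizon})"
    and v_deriv: "(v has_real_derivative snd (langmuir_accel (clip (x t, y t)))) (at t within {0..horizon})"
proof -
  note bl = bounded_linear.has_vector_derivative
  note q = bl[OF bounded_linear_fst \<phi>_deriv[OF t]] and p = bl[OF bounded_linear_snd \<phi>_deriv[OF t]]
  show "(x has_real_derivative u t) (at t within {0..horizon})"
    "(y has_real_derivative v t) (at t within {0..horizon})"
    "(u has_real_derivative fst (langmuir_accel (clip (x t, y t)))) (at t within {0..horizon})"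
    "(v has_real_derivative snd (langmuir_accel (clip (x t, y t)))) (at t within {0..horizon})"
    using bl[OF bounded_linear_fst q] bl[OF bounded_linear_snd q]
      bl[OF bounded_linear_fst p] bl[OF bounded_linear_snd p]
    unfolding x_def[abs_def] y_def[abs_def] u_def[abs_def] v_def[abs_def] has_real_derivative_iff_has_vector_derivative
    by (simp_all add: clipped_field_def)
qed

lemma x_nonincreasing: "0 \<le> s \<Longrightarrow> s \<le> t \<Longrightarrow> t \<le> horizon \<Longrightarrow> x t \<le> x s"
proof -
  have u_nonpos: "u t \<le> 0" if "t \<in> {0..horizon}" for t
  proof -
    have "- u 0 \<le> - u t"
    proof (rule nondecreasing_within_interval[of horizon "\<lambda>t. - u t"
          "\<lambda>t. - fst (langmuir_accel (clip (x t, y t)))"])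
      show "((\<lambda>t. - u t) has_real_derivative - fst (langmuir_accel (clip (x t, y t)))) (at t within {0..horizon})"
        if "t \<in> {0..horizon}" for t
        by (rule DERIV_minus[OF u_deriv[OF that]])
      show "0 \<le> - fst (langmuir_accel (clip (x t, y t)))" for t
        by (simp add: langmuir_accel_def clip_def)
    qed (use that in auto)
    then show ?thesis by (simp add: u_def initial)
  qed
  assume st: "0 \<le> s" "s \<le> t" "t \<le> horizon"
  have "- x s \<le> - x t"
    by (rule nondecreasing_within_interval[of horizon _ "\<lambda>t. - u t"])
      (use st u_nonpos in \<open>auto intro!: derivative_intros x_deriv\<close>)
  then show ?thesis by simp
qed

lemma brake_orbit_while_unclipped:
  assumes t: "t \<in> {0..horizon}" and x: "0 \<le> x t"
    and y: "\<And>s. s \<in> {0..t} \<Longrightarrow> height_floor \<le> y s"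
  shows "brake_orbit a t x y u v"
proof
  have x_nonneg: "0 \<le> x s" if "s \<in> {0..t}" for s
    using x_nonincreasing[of s t] that t x by simp
  then show "\<And>s. s \<in> {0..t} \<Longrightarrow> 0 \<le> x s" .
  have "fst (langmuir_accel (clip (x s, y s))) = - 8 * x s / ((x s)\<^sup>2 + (y s)\<^sup>2) powr (3/2)"
    "snd (langmuir_accel (clip (x s, y s)))
      = - 8 * y s / ((x s)\<^sup>2 + (y s)\<^sup>2) powr (3/2) + 1 / (y s)\<^sup>2" if "s \<in> {0..t}" for s
    using x_nonneg[OF that] y[OF that]
    by (simp_all add: langmuir_accel_def clip_def norm_Pair powr_three_halves)
  note accel = this
  have sub: "{0..t} \<subseteq> {0..horizon}" using t by auto
  have pos: "0 < y s" if "s \<in> {0..t}" for s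
    using y[OF that] height_floor_pos by simp
  show "solves_langmuir_system {0..t} x y u v"
    unfolding solves_langmuir_system_def
  proof (intro ballI conjI)
    fix s assume s: "s \<in> {0..t}"
    then have s': "s \<in> {0..horizon}" using sub by auto
    show "0 < y s" by (rule pos[OF s])
    show "(x has_real_derivative u s) (at s within {0..t})"
      "(y has_real_derivative v s) (at s within {0..t})"
      by (rule DERIV_subset[OF x_deriv[OF s'] sub] DERIV_subset[OF y_deriv[OF s'] sub])+
    show "(u has_real_derivative - 8 * x s / ((x s)\<^sup>2 + (y s)\<^sup>2) powr (3/2)) (at s within {0..t})"
      using DERIV_subset[OF u_deriv[OF s'] sub] by (simp only: accel[OF s])
    show "(v has_real_derivative - 8 * y s / ((x s)\<^sup>2 + (y s)\<^sup>2) powr (3/2) + 1 / (y s)\<^sup>2) (at s within {0..t})"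
      using DERIV_subset[OF v_deriv[OF s'] sub] by (simp only: accel[OF s])
  qed
qed (use t a_bounds in \<open>auto simp: x_def y_def u_def v_def initial\<close>)

lemma y_continuous: "continuous_on {0..horizon} y"
  using y_deriv by (intro DERIV_continuous_on)

lemma x_continuous: "continuous_on {0..horizon} x"
  using x_deriv by (intro DERIV_continuous_on)

text \<open>
  At the first time at which \<open>y\<close> descends to the floor, the orbit so far is a genuine brake orbit,
  whose height is bounded below by a larger number.
\<close>

lemma y_above_floor:
  assumes t: "t \<in> {0..horizon}" and x: "0 \<le> x t" 
  shows "height_floor \<le> y t"
proof (rule ccontr)
  assume "\<not> height_floor \<le> y t"
  define S where "S = {s\<in>{0..t}. y s \<le> height_floor}"
  have y0: "height_floor < y 0" by (simp add: y_def initial height_floor_def)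
  have cont: "continuous_on {0..s} y" if "s \<le> t" for s
    using that t by (intro continuous_on_subset[OF y_continuous]) auto
  have "closed ({0..t} \<inter> y -` {..height_floor})"
    by (intro continuous_closed_preimage cont) auto
  moreover have "S = {0..t} \<inter> y -` {..height_floor}" by (auto simp: S_def)
  ultimately have "compact S" by (auto simp: compact_eq_bounded_closed intro: bounded_subset[of "{0..t}"])
  moreover have "t \<in> S" using \<open>\<not> height_floor \<le> y t\<close> t by (simp add: S_def)
  ultimately obtain s where s: "s \<in> S" and s_min: "\<And>s'. s' \<in> S \<Longrightarrow> s \<le> s'"
    using compact_attains_inf[of S] by blast
  have st: "0 \<le> s" "s \<le> t" "y s \<le> height_floor" using s by (auto simp: S_def)
  obtain s' where s': "0 \<le> s'" "s' \<le> s" "y s' = height_floor"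
    using IVT2'[of y s height_floor 0] st y0 cont[of s] by auto
  then have "s \<le> s'" using st by (intro s_min) (auto simp: S_def)
  then have "y s = height_floor" using s' by simp
  have "brake_orbit a s x y u v"
  proof (rule brake_orbit_while_unclipped)
    show "height_floor \<le> y s'" if "s' \<in> {0..s}" for s'
      using s_min[of s'] that st \<open>y s = height_floor\<close> by (force simp: S_def)
    show "0 \<le> x s" using x_nonincreasing[of s t] st t x by simp
  qed (use st t in auto)
  then have "1 / 204800 \<le> y s" using brake_orbit.y_lower[of a s x y u v s] st by simp
  then show False using \<open>y s = height_floor\<close> by (simp add: height_floor_def)
qed

lemma brake_orbit_before_crossing:
  assumes t: "t \<in> {0..horizon}" and x: "0 \<le> x t"
  shows "brake_orbit a t x y u v"
proof (rule brake_orbit_while_unclipped[OF t x])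
  fix s assume "s \<in> {0..t}"
  then show "height_floor \<le> y s"
    using x_nonincreasing[of s t] t x by (intro y_above_floor) auto
qed

text \<open>
  An orbit that does not cross the axis before the horizon would be a brake orbit that lasts too
  long.
\<close>

lemma crossing_exists: "\<exists>t\<in>{0..horizon}. x t = 0"
proof -
  have "x horizon < 0"
  proof (rule ccontr)
    assume "\<not> x horizon < 0"
    then have "brake_orbit a horizon x y u v"
      by (intro brake_orbit_before_crossing) (auto simp: horizon_def)
    then have "horizon \<le> 20000" by (rule brake_orbit.\<tau>_upper)
    then show False by (simp add: horizon_def)
  qed
  moreover have "0 \<le> x 0"
    using a_bounds(1) order_trans[of 0 "sqrt 3" a] by (simp add: x_def initial)
  ultimately show ?thesis
    using IVT2'[of x horizon 0 0] x_continuous by (auto simp: horizon_def)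
qed

lemma crossing_pos: "x t = 0 \<Longrightarrow> t \<in> {0..horizon} \<Longrightarrow> 0 < t"
  using a_bounds(1) less_le_trans[of 0 "sqrt 3" a] by (cases "t = 0") (auto simp: x_def initial)

text \<open>
  Up to its last crossing the orbit is a brake orbit, whose horizontal velocity is strictly negative
  after time \<open>0\<close>.
\<close>

lemma crossing_unique:
  assumes "s \<in> {0..horizon}" "t \<in> {0..horizon}" "x s = 0" "x t = 0"
  shows "s = t"
proof -
  have False if st: "s \<in> {0..horizon}" "t \<in> {0..horizon}" "x s = 0" "x t = 0" "s < t" for s t
  proof -
    obtain c where c: "s < c" "c < t" "x t - x s = (t - s) * u c"
      by (rule mvt_within_interval[of horizon x u s t]) (use st x_deriv in auto)
    have "u c < 0"
      using brake_orbit.u_neg[OF brake_orbit_before_crossing[of t], of c] st c by simp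
    then show False using c st by simp
  qed
  then show ?thesis using assms by (metis linorder_neqE)
qed

end

section \<open>Shooting from the zero velocity curve\<close>

lemma clipped_flow_exists:
  obtains \<Phi> :: "real \<Rightarrow> real \<Rightarrow> phase_point"
  where "\<And>a. sqrt 3 \<le> a \<Longrightarrow> a \<le> sqrt 63 \<Longrightarrow> clipped_orbit a (\<Phi> a)"
    and "continuous_on (UNIV \<times> {0..horizon}) (\<lambda>(a, t). \<Phi> a t)"
proof -
  have lip_pos: "clipped_lipschitz > 0" by (simp add: clipped_lipschitz_def height_floor_pos add_pos_pos)
  have "\<exists>\<phi>. \<phi> 0 = ((a, 1), (0, 0)) \<and> (\<forall>t\<in>{0..horizon}.
      (\<phi> has_vector_derivative clipped_field (\<phi> t)) (at t within {0..horizon}))" for a :: real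
    by (rule lipschitz_ode_solution_exists[OF clipped_field_lipschitz lip_pos]) (simp add: horizon_def)
  then obtain \<Phi> where init: "\<And>a::real. \<Phi> a 0 = ((a, 1), (0, 0))"
    and deriv: "\<And>a t. t \<in> {0..horizon} \<Longrightarrow>
      (\<Phi> a has_vector_derivative clipped_field (\<Phi> a t)) (at t within {0..horizon})"
    by metis
  define K where "K = exp (clipped_lipschitz * horizon)"
  have dep: "dist (\<Phi> a t) (\<Phi> b t) \<le> K * dist a b" if t: "t \<in> {0..horizon}" for a b t
  proof -
    have "norm (\<Phi> a t - \<Phi> b t) \<le> exp (clipped_lipschitz * t) * norm (\<Phi> a 0 - \<Phi> b 0)"
      by (rule lipschitz_ode_dependence[OF clipped_field_lipschitz deriv deriv t])
    also have "norm (\<Phi> a 0 - \<Phi> b 0) = dist a b" by (simp add: init norm_Pair dist_norm)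
    also have "exp (clipped_lipschitz * t) * dist a b \<le> K * dist a b"
      unfolding K_def using lip_pos t by (intro mult_right_mono) auto
    finally show ?thesis by (simp add: dist_norm)
  qed
  have "local_lipschitz {0..horizon} UNIV (\<lambda>t a. \<Phi> a t)"
  proof (rule local_lipschitzI)
    fix t a :: real
    show "\<exists>e>0. \<exists>L. \<forall>s\<in>cball t e \<inter> {0..horizon}. L-lipschitz_on (cball a e \<inter> UNIV) (\<lambda>a. \<Phi> a s)"
      by (rule exI[of _ 1]) (use dep in \<open>auto intro!: exI[of _ K] lipschitz_onI simp: K_def\<close>)
  qed
  then have *: "continuous_on ({0..horizon} \<times> UNIV) (\<lambda>(t, a). \<Phi> a t)"
  proof (rule continuous_on_TimesI)
    show "continuous_on {0..horizon} (\<Phi> a)" for a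
      using deriv by (intro continuous_on_vector_derivative)
  qed
  have "continuous_on (UNIV \<times> {0..horizon}) (\<lambda>p. (\<lambda>(t, a). \<Phi> a t) (prod.swap p))"
    by (rule continuous_on_compose2[OF * continuous_on_swap]) auto
  then have "continuous_on (UNIV \<times> {0..horizon}) (\<lambda>(a, t). \<Phi> a t)"
    by (simp add: case_prod_unfold)
  moreover have "clipped_orbit a (\<Phi> a)" if "sqrt 3 \<le> a" "a \<le> sqrt 63" for a
    using that init deriv by unfold_locales
  ultimately show thesis using that by blast
qed

text \<open>
  The starting points whose orbit crosses the axis with \<open>v \<le> 0\<close> and those with \<open>v \<ge> 0\<close> form
  two closed sets, as projections of compact sets. They cover the interval of all starting points and
  contain one end of it each, so by connectedness they meet. As the crossing time of an orbit is
  unique, a common point has \<open>v = 0\<close>. It is not \<open>sqrt 63\<close>, where \<open>v > 0\<close>, hence its energy is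
  negative.
\<close>

lemma perpendicular_crossing_exists:
  obtains a \<tau> x y u v where "brake_orbit a \<tau> x y u v" "a < sqrt 63" "0 < \<tau>" "x \<tau> = 0" "v \<tau> = 0"
proof -
  obtain \<Phi> :: "real \<Rightarrow> real \<Rightarrow> phase_point"
    where orbit: "\<And>a. sqrt 3 \<le> a \<Longrightarrow> a \<le> sqrt 63 \<Longrightarrow> clipped_orbit a (\<Phi> a)"
      and cont: "continuous_on (UNIV \<times> {0..horizon}) (\<lambda>(a, t). \<Phi> a t)"
    using clipped_flow_exists by blast
  define J where "J = {sqrt 3..sqrt 63::real}"
  define x where "x a = clipped_orbit.x (\<Phi> a)" for a
  define y where "y a = clipped_orbit.y (\<Phi> a)" for a
  define u where "u a = clipped_orbit.u (\<Phi> a)" for a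
  define v where "v a = clipped_orbit.v (\<Phi> a)" for a
  have crossing: "\<exists>t\<in>{0..horizon}. x a t = 0" if "a \<in> J" for a
    using clipped_orbit.crossing_exists[OF orbit, of a] that by (simp add: J_def x_def)
  have unique: "s = t" if "a \<in> J" "s \<in> {0..horizon}" "t \<in> {0..horizon}" "x a s = 0" "x a t = 0" for a s t
    using clipped_orbit.crossing_unique[OF orbit, of a s t] that by (simp add: J_def x_def)
  have brake: "brake_orbit a t (x a) (y a) (u a) (v a) \<and> 0 < t"
    if "a \<in> J" "t \<in> {0..horizon}" "x a t = 0" for a t
    using clipped_orbit.brake_orbit_before_crossing[OF orbit, of a t]
      clipped_orbit.crossing_pos[OF orbit, of a t] that
    by (simp add: J_def x_def y_def u_def v_def)
  have compact_crossing: "compact {p \<in> J \<times> {0..horizon}. x (fst p) (snd p) = 0 \<and> v (fst p) (snd p) \<in> C}"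
    if C: "closed C" for C
  proof -
    have c: "continuous_on (J \<times> {0..horizon}) (\<lambda>p. \<Phi> (fst p) (snd p))"
      using continuous_on_subset[OF cont, of "J \<times> {0..horizon}"] by (auto simp: case_prod_unfold)
    have "continuous_on (J \<times> {0..horizon}) (\<lambda>p. (x (fst p) (snd p), v (fst p) (snd p)))"
    proof (rule continuous_on_eq)
      show "continuous_on (J \<times> {0..horizon})
          (\<lambda>p. (fst (fst (\<Phi> (fst p) (snd p))), snd (snd (\<Phi> (fst p) (snd p)))))"
        by (intro continuous_intros c)
      show "(fst (fst (\<Phi> (fst p) (snd p))), snd (snd (\<Phi> (fst p) (snd p))))
          = (x (fst p) (snd p), v (fst p) (snd p))" if "p \<in> J \<times> {0..horizon}" for p
        using orbit[of "fst p"] that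
        by (auto simp: J_def x_def v_def clipped_orbit.x_def clipped_orbit.v_def)
    qed
    then have "closed ((J \<times> {0..horizon}) \<inter> (\<lambda>p. (x (fst p) (snd p), v (fst p) (snd p))) -` ({0} \<times> C))"
      by (rule continuous_closed_preimage) (auto simp: J_def intro!: closed_Times C)
    then have "compact ((J \<times> {0..horizon}) \<inter> ((J \<times> {0..horizon}) \<inter>
        (\<lambda>p. (x (fst p) (snd p), v (fst p) (snd p))) -` ({0} \<times> C)))"
      by (intro compact_Int_closed) (auto simp: J_def intro!: compact_Times)
    then show ?thesis by (rule back_subst[of compact]) auto
  qed
  define S where "S C = {a\<in>J. \<exists>t\<in>{0..horizon}. x a t = 0 \<and> v a t \<in> C}" for C
  have S_closed: "closed (S C)" if "closed C" for C
  proof -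
    have "S C = fst ` {p \<in> J \<times> {0..horizon}. x (fst p) (snd p) = 0 \<and> v (fst p) (snd p) \<in> C}"
      by (force simp: S_def image_iff)
    then show ?thesis
      using compact_continuous_image[OF continuous_on_fst[OF continuous_on_id] compact_crossing[OF that]]
      by (simp add: compact_imp_closed)
  qed
  have zero_energy: "0 < v (sqrt 63) t" if "t \<in> {0..horizon}" "x (sqrt 63) t = 0" for t
  proof -
    have "sqrt 63 \<in> J" by (simp add: J_def)
    then show ?thesis
      using brake[OF _ that] brake_orbit.v_pos_if_zero_energy that(2) by blast
  qed
  have "S {..0} \<inter> J \<noteq> {}"
  proof -
    have a: "sqrt 3 \<in> J" by (simp add: J_def)
    then obtain t where t: "t \<in> {0..horizon}" "x (sqrt 3) t = 0" using crossing by blast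
    have "v (sqrt 3) t \<le> 0"
      using brake[OF a t] brake_orbit.v_nonpos_if_narrow by blast
    then have "sqrt 3 \<in> S {..0} \<inter> J" using a t by (auto simp: S_def)
    then show ?thesis by blast
  qed
  moreover have "S {0..} \<inter> J \<noteq> {}"
  proof -
    have a: "sqrt 63 \<in> J" by (simp add: J_def)
    then obtain t where t: "t \<in> {0..horizon}" "x (sqrt 63) t = 0" using crossing by blast
    then have "sqrt 63 \<in> S {0..} \<inter> J" using a zero_energy[OF t] by (auto simp: S_def)
    then show ?thesis by blast
  qed
  moreover have "J \<subseteq> S {..0} \<union> S {0..}"
    using crossing by (force simp: S_def)
  moreover have "connected J" by (simp add: J_def)
  ultimately have "S {..0} \<inter> S {0..} \<inter> J \<noteq> {}"
    using connected_closedD[of J "S {..0}" "S {0..}"] S_closed by blast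
  then obtain a where a: "a \<in> J" and in_S: "a \<in> S {..0}" "a \<in> S {0..}" by blast
  obtain s where s: "s \<in> {0..horizon}" "x a s = 0" "v a s \<le> 0"
    using in_S(1) by (auto simp: S_def)
  obtain t where t: "t \<in> {0..horizon}" "x a t = 0" "0 \<le> v a t"
    using in_S(2) by (auto simp: S_def)
  have "s = t" using unique[OF a s(1) t(1) s(2) t(2)] .
  then have "v a t = 0" using s t by simp
  moreover have "a \<noteq> sqrt 63" using zero_energy[of t] t \<open>v a t = 0\<close> by auto
  then have "a < sqrt 63" using a by (simp add: J_def)
  ultimately show thesis using that brake[OF a t(1,2)] t by blast
qed

section \<open>Time reversal and scaling\<close>

text \<open>
  Applied to each component of a brake orbit: time is reversed, so that the last instant comes
  first, and slowed down by the factor \<open>m\<close>.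
\<close>

lemma reversed_scaled_deriv:
  fixes f :: "real \<Rightarrow> real"
  assumes f: "\<And>t. t \<in> {0..\<tau>} \<Longrightarrow> (f has_real_derivative D t) (at t within {0..\<tau>})"
    and "0 < m" and t: "t \<in> {0..m * \<tau>}"
  shows "((\<lambda>t. c * f (\<tau> - t / m)) has_real_derivative (- c / m * D (\<tau> - t / m))) (at t within {0..m * \<tau>})"
proof -
  have mem: "\<tau> - s / m \<in> {0..\<tau>}" if "s \<in> {0..m * \<tau>}" for s
    using that \<open>0 < m\<close> by (auto simp: field_simps)
  have "((\<lambda>t. \<tau> - t / m) has_real_derivative - (1 / m)) (at t within {0..m * \<tau>})"
    using \<open>0 < m\<close> by (auto intro!: derivative_eq_intros)
  moreover have "(f has_real_derivative D (\<tau> - t / m)) (at (\<tau> - t / m) within (\<lambda>t. \<tau> - t / m) ` {0..m * \<tau>})"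
    by (rule DERIV_subset[OF f[OF mem[OF t]]]) (use mem in auto)
  ultimately have "(f \<circ> (\<lambda>t. \<tau> - t / m) has_real_derivative D (\<tau> - t / m) * - (1 / m)) (at t within {0..m * \<tau>})"
    by (intro DERIV_image_chain)
  from DERIV_cmult[OF this, of c] show ?thesis by (simp add: o_def mult.commute)
qed

text \<open>
  The equations are invariant under time reversal, and under scaling positions by \<open>\<mu>\<^sup>2\<close>, time by
  \<open>\<mu> ^ 3\<close> and velocities by \<open>1 / \<mu>\<close>, which divides the energy by \<open>\<mu>\<^sup>2\<close>. This reaches every
  negative energy, and the perpendicular crossing becomes the starting point. Its speed there has
  the prescribed value because energy is conserved.
\<close>

lemma brake_orbit_gives_langmuir_orbit:
  assumes "brake_orbit a \<tau> x y u v" "a < sqrt 63" "0 < \<tau>" "x \<tau> = 0" "v \<tau> = 0" "E < 0"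
  shows "\<exists>h T x y u v. langmuir_orbit E h T x y u v"
proof -
  interpret brake_orbit a \<tau> x y u v by fact
  define e where "e = - 4 / sqrt (a\<^sup>2 + 1) + 1 / 2"
  have "0 \<le> a" using a_bounds(1) by (rule order_trans[rotated]) simp
  then have "a\<^sup>2 < (sqrt 63)\<^sup>2" using \<open>a < sqrt 63\<close> by (intro power_strict_mono) auto
  then have "sqrt (a\<^sup>2 + 1) < sqrt (8\<^sup>2)" by (intro real_sqrt_less_mono) auto
  then have "sqrt (a\<^sup>2 + 1) < 8" by simp
  moreover have "0 < sqrt (a\<^sup>2 + 1)" by (simp add: add_nonneg_pos)
  ultimately have "e < 0" by (simp add: e_def field_simps)
  define \<mu> where "\<mu> = sqrt (e / E)"
  have \<mu>: "0 < \<mu>" using \<open>e < 0\<close> \<open>E < 0\<close> by (simp add: \<mu>_def divide_neg_neg)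
  have \<mu>2: "\<mu>\<^sup>2 = e / E" using \<open>e < 0\<close> \<open>E < 0\<close> by (simp add: \<mu>_def divide_nonpos_neg)
  have E: "E = e / \<mu>\<^sup>2" using \<open>e < 0\<close> \<open>E < 0\<close> by (simp add: \<mu>2)
  define \<sigma> where "\<sigma> t = \<tau> - t / \<mu> ^ 3" for t
  define X where "X t = \<mu>\<^sup>2 * x (\<sigma> t)" for t
  define Y where "Y t = \<mu>\<^sup>2 * y (\<sigma> t)" for t
  define U where "U t = - (1 / \<mu>) * u (\<sigma> t)" for t
  define V where "V t = - (1 / \<mu>) * v (\<sigma> t)" for t
  have m: "0 < \<mu> ^ 3" using \<mu> by simp
  have \<sigma>_mem: "\<sigma> t \<in> {0..\<tau>}" if "t \<in> {0..\<mu> ^ 3 * \<tau>}" for t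
    using that m by (auto simp: \<sigma>_def field_simps)
  have system': "solves_langmuir_system {0..\<mu> ^ 3 * \<tau>} X Y U V"
    unfolding solves_langmuir_system_def
  proof (intro ballI conjI)
    fix t assume t: "t \<in> {0..\<mu> ^ 3 * \<tau>}"
    note pos = y_pos[OF \<sigma>_mem[OF t]] r_pos[OF \<sigma>_mem[OF t]]
    have "((X t)\<^sup>2 + (Y t)\<^sup>2) powr (3/2) = sqrt (\<mu> ^ 4 * ((x (\<sigma> t))\<^sup>2 + (y (\<sigma> t))\<^sup>2)) ^ 3"
      by (simp add: X_def Y_def powr_three_halves algebra_simps)
    also have "sqrt (\<mu> ^ 4 * ((x (\<sigma> t))\<^sup>2 + (y (\<sigma> t))\<^sup>2)) = \<mu>\<^sup>2 * r (\<sigma> t)"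
      by (rule real_sqrt_unique) (auto simp: r_def power_mult_distrib)
    finally have R: "((X t)\<^sup>2 + (Y t)\<^sup>2) powr (3/2) = (\<mu>\<^sup>2 * r (\<sigma> t)) ^ 3" .
    show "0 < Y t" using pos \<mu> by (simp add: Y_def)
    show "(X has_real_derivative U t) (at t within {0..\<mu> ^ 3 * \<tau>})"
      using reversed_scaled_deriv[OF x_deriv m t, of "\<mu>\<^sup>2"] \<mu>
      by (simp add: X_def[abs_def] U_def \<sigma>_def power2_eq_square power3_eq_cube)
    show "(Y has_real_derivative V t) (at t within {0..\<mu> ^ 3 * \<tau>})"
      using reversed_scaled_deriv[OF y_deriv m t, of "\<mu>\<^sup>2"] \<mu>
      by (simp add: Y_def[abs_def] V_def \<sigma>_def power2_eq_square power3_eq_cube)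
    have "- (- (1 / \<mu>)) / \<mu> ^ 3 * (- 8 * x (\<sigma> t) / r (\<sigma> t) ^ 3)
        = - 8 * X t / (\<mu>\<^sup>2 * r (\<sigma> t)) ^ 3"
      using \<mu> pos by (simp add: X_def field_simps power_mult_distrib eval_nat_numeral)
    then show "(U has_real_derivative - 8 * X t / ((X t)\<^sup>2 + (Y t)\<^sup>2) powr (3/2)) (at t within {0..\<mu> ^ 3 * \<tau>})"
      using reversed_scaled_deriv[OF u_deriv m t, of "- (1 / \<mu>)"]
      unfolding R U_def[abs_def] \<sigma>_def[symmetric] by (simp only:)
    have "- (- (1 / \<mu>)) / \<mu> ^ 3 * (- 8 * y (\<sigma> t) / r (\<sigma> t) ^ 3 + 1 / (y (\<sigma> t))\<^sup>2)
        = - 8 * Y t / (\<mu>\<^sup>2 * r (\<sigma> t)) ^ 3 + 1 / (Y t)\<^sup>2"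
      using \<mu> pos by (simp add: Y_def field_simps power_mult_distrib eval_nat_numeral)
    then show "(V has_real_derivative - 8 * Y t / ((X t)\<^sup>2 + (Y t)\<^sup>2) powr (3/2) + 1 / (Y t)\<^sup>2)
        (at t within {0..\<mu> ^ 3 * \<tau>})"
      using reversed_scaled_deriv[OF v_deriv m t, of "- (1 / \<mu>)"]
      unfolding R V_def[abs_def] \<sigma>_def[symmetric] by (simp only:)
  qed
  have \<tau>: "\<tau> \<in> {0..\<tau>}" using \<open>0 < \<tau>\<close> by simp
  have "r \<tau> = y \<tau>" using y_pos[OF \<tau>] by (simp add: r_def \<open>x \<tau> = 0\<close>)
  then have "(u \<tau>)\<^sup>2 / 4 = 7 / (2 * y \<tau>) + e"
    using energy_conserved[OF \<tau>] by (simp add: \<open>v \<tau> = 0\<close> e_def)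
  moreover have "7 / (2 * Y 0) + E = (7 / (2 * y \<tau>) + e) / \<mu>\<^sup>2"
    by (simp add: Y_def \<sigma>_def E add_divide_distrib)
  ultimately have "7 / (2 * Y 0) + E = ((u \<tau>)\<^sup>2 / 4) / \<mu>\<^sup>2" by (simp only:)
  also have "\<dots> = (U 0 / 2)\<^sup>2" by (simp add: U_def \<sigma>_def power_divide)
  finally have speed: "7 / (2 * Y 0) + E = (U 0 / 2)\<^sup>2" .
  have "U 0 > 0" using u_neg[of \<tau>] \<open>0 < \<tau>\<close> \<mu> by (simp add: U_def \<sigma>_def divide_neg_pos)
  then have "U 0 = 2 * sqrt (7 / (2 * Y 0) + E)" by (simp add: speed)
  moreover have "admissible_height E (Y 0)"
    using y_pos[OF \<tau>] \<mu> speed by (simp add: admissible_height_def Y_def \<sigma>_def)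
  ultimately have "solves_langmuir_problem E (Y 0) {0..\<mu> ^ 3 * \<tau>} X Y U V"
    using system' \<open>E < 0\<close> by (simp add: solves_langmuir_problem_def X_def V_def \<sigma>_def assms(4,5))
  moreover have "U (\<mu> ^ 3 * \<tau>) = 0" "V (\<mu> ^ 3 * \<tau>) = 0"
    using \<mu> by (simp_all add: U_def V_def \<sigma>_def init)
  ultimately have "langmuir_orbit E (Y 0) (\<mu> ^ 3 * \<tau>) X Y U V"
    using \<mu> \<open>0 < \<tau>\<close> by (simp add: langmuir_orbit_def)
  then show ?thesis by blast
qed

theorem theorem1:
  fixes E :: real
  assumes "E < 0"
  shows "\<exists>h T x y u v. langmuir_orbit E h T x y u v"
  using perpendicular_crossing_exists brake_orbit_gives_langmuir_orbit[OF _ _ _ _ _ assms] by metis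

end
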